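(* For every integer $n\ge 1$, $|\mathcal{S}_n(23;\,3\to 1)| = C_n$, where $C_n=\frac{1}{n+1}\binom{2n}{n}$ is the $n$-th Catalan number.
   Context: $[n]=\{1,\dots,n\}$, and $\mathcal{S}_n$ is the set of permutations $\pi=\pi_1\pi_2\cdots\pi_n$ of $[n]$ in one-line notation. The permutation $\hat\pi$: for $\pi\in\mathcal{S}_n$, $\hat\pi\in\mathcal{S}_n$ is the permutation whose cycle form is obtained from the word $\pi_1\cdots\pi_n$ by inserting a left parenthesis before each left-to-right maximum (an entry larger than all entries to its left) and a right parenthesis immediately before the next left-to-right maximum, or at the end of the word. A cycle $(c_1,c_2,\dots,c_s)$ means $c_1\mapsto c_2\mapsto\cdots\mapsto c_s\mapsto c_1$. Example: if $\pi=2537164$ then $\hat\pi=(2)(53)(7164)$. Arrow patterns: an arrow pattern of size $k$ is a pair $(\nu;H)$ where $\nu=\nu_1\cdots\nu_m$ is a word of distinct positive integers, $H$ is a collection of arrows $b_i\to c_i$, and the set of all integers appearing in $\nu$ or $H$ is $[k]$. A permutation $\pi\in\mathcal{S}_n$ contains $(\nu;H)$ if there are a set $X=\{x_1<x_2<\cdots<x_k\}\subseteq[n]$ and indices $t_1<\cdots<t_m$ such that $\pi_{t_1}\pi_{t_2}\cdots\pi_{t_m}=x_{\nu_1}x_{\nu_2}\cdots x_{\nu_m}$ and $\hat\pi(x_{b_i})=x_{c_i}$ for every arrow $b_i\to c_i$ in $H$. Otherwise $\pi$ avoids $(\nu;H)$. $\mathcal{S}_n(\nu;H)$ is the set of permutations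 in $\mathcal{S}_n$ avoiding $(\nu;H)$. *)

theory Defs
  imports Complex_Main "HOL-Combinatorics.Combinatorics"
begin

text \<open>
  A permutation of \<open>{1..n}\<close> in one-line notation is a list in
  \<open>permutations_of_set {1..n}\<close>; list positions count from 0, letters from 1.
\<close>

definition left_to_right_max :: "nat list \<Rightarrow> nat \<Rightarrow> bool" where
  "left_to_right_max w i \<longleftrightarrow> i < length w \<and> (\<forall>j<i. w ! j < w ! i)"

text \<open>
  The factors of a word cut before each left-to-right maximum. The head of a factor exceeds all
  letters before it, so the next left-to-right maximum is the first later letter that is larger
  than this head; see \<open>hd_ltr_blocks\<close> below.
\<close>

function ltr_blocks :: "nat list \<Rightarrow> nat list list" where
  "ltr_blocks [] = []"
| "ltr_blocks (x # xs) =
     (x # takeWhile (\<lambda>y. y \<le> x) xs) # ltr_blocks (dropWhile (\<lambda>y. y \<le> x) xs)"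
  by pat_completeness auto
termination
  by (relation "measure length") (auto simp: less_Suc_eq_le length_dropWhile_le)

lemma concat_ltr_blocks: "concat (ltr_blocks w) = w"
  by (induction w rule: ltr_blocks.induct) simp_all

lemma ltr_blocks_nonempty: "[] \<notin> set (ltr_blocks w)"
  by (induction w rule: ltr_blocks.induct) auto

lemma left_to_right_max_append:
  "left_to_right_max (u @ v) (length u + i) \<longleftrightarrow>
     left_to_right_max v i \<and> (\<forall>a\<in>set u. a < v ! i)"
proof -
  have "(\<forall>j<length u + i. (u @ v) ! j < v ! i) \<longleftrightarrow>
      (\<forall>j<length u. u ! j < v ! i) \<and> (\<forall>j<i. v ! j < v ! i)" (is "?L \<longleftrightarrow> ?R")
  proof
    assume L: ?L
    show ?R
    proof (intro conjI allI impI)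
      fix j assume "j < length u"
      then show "u ! j < v ! i" using L[rule_format, of j] by (simp add: nth_append)
    next
      fix j assume "j < i"
      then show "v ! j < v ! i" using L[rule_format, of "length u + j"] by simp
    qed
  next
    assume R: ?R
    show ?L
    proof (intro allI impI)
      fix j assume "j < length u + i"
      then show "(u @ v) ! j < v ! i"
        using R by (cases "j < length u") (auto simp: nth_append)
    qed
  qed
  then show ?thesis
    by (auto simp: left_to_right_max_def all_set_conv_all_nth)
qed

text \<open>The first letters of the factors are exactly the left-to-right maxima.\<close>

lemma hd_ltr_blocks: "hd ` set (ltr_blocks w) = {w ! i | i. left_to_right_max w i}"
proof (induction w rule: ltr_blocks.induct)
  case 1
  show ?case by (simp add: left_to_right_max_def)
next
  case (2 x xs)
  define u where "u = x # takeWhile (\<lambda>y. y \<le> x) xs"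
  define v where "v = dropWhile (\<lambda>y. y \<le> x) xs"
  have w: "x # xs = u @ v"
    by (simp add: u_def v_def)
  have u_le: "a \<le> x" if "a \<in> set u" for a
    using that by (auto simp: u_def dest: set_takeWhileD)
  have v_gt: "x < v ! i" if "left_to_right_max v i" for i
  proof -
    have "v \<noteq> []" using that by (auto simp: left_to_right_max_def)
    then have "x < v ! 0"
      using hd_dropWhile[of "\<lambda>y. y \<le> x" xs] by (simp add: v_def hd_conv_nth)
    moreover have "v ! 0 \<le> v ! i"
      using that by (cases i) (auto simp: left_to_right_max_def intro: less_imp_le)
    ultimately show ?thesis by simp
  qed
  have max_v: "left_to_right_max (u @ v) (length u + i) \<longleftrightarrow> left_to_right_max v i" for i
    using u_le v_gt by (auto simp: left_to_right_max_append intro: le_less_trans)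
  have max_u: "left_to_right_max (u @ v) i \<longleftrightarrow> i = 0" if "i < length u" for i
  proof
    assume m: "left_to_right_max (u @ v) i"
    show "i = 0"
    proof (rule ccontr)
      assume "i \<noteq> 0"
      then have "u ! 0 < u ! i"
        using m that by (auto simp: left_to_right_max_def nth_append)
      moreover have "u ! i \<le> x" using that by (intro u_le nth_mem)
      ultimately show False by (simp add: u_def)
    qed
  next
    assume "i = 0"
    then show "left_to_right_max (u @ v) i"
      using that by (simp add: left_to_right_max_def)
  qed
  have "{(u @ v) ! i | i. left_to_right_max (u @ v) i} =
      insert x {v ! i | i. left_to_right_max v i}" (is "?L = ?R")
  proof
    show "?L \<subseteq> ?R"
    proof
      fix y assume "y \<in> ?L"
      then obtain i where i: "y = (u @ v) ! i" "left_to_right_max (u @ v) i" by blast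
      show "y \<in> ?R"
      proof (cases "i < length u")
        case True
        then show ?thesis using i max_u by (simp add: u_def)
      next
        case False
        then obtain j where "i = length u + j" by (metis le_Suc_ex not_less)
        then show ?thesis using i max_v by auto
      qed
    qed
    show "?R \<subseteq> ?L"
    proof
      fix y assume "y \<in> ?R"
      then consider "y = x" | i where "y = v ! i" "left_to_right_max v i" by blast
      then show "y \<in> ?L"
      proof cases
        case 1
        have "left_to_right_max (u @ v) 0" using max_u[of 0] by (simp add: u_def)
        moreover have "y = (u @ v) ! 0" using 1 by (simp add: u_def)
        ultimately show ?thesis by blast
      next
        case 2
        then have "left_to_right_max (u @ v) (length u + i)" by (simp add: max_v)
        moreover have "y = (u @ v) ! (length u + i)" using 2 by simp
        ultimately show ?thesis by blast
      qed
    qed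
  qed
  moreover have "hd ` set (ltr_blocks (x # xs)) = insert x (hd ` set (ltr_blocks v))"
    by (simp add: v_def)
  moreover have "hd ` set (ltr_blocks v) = {v ! i | i. left_to_right_max v i}"
    using 2 by (simp add: v_def)
  ultimately show ?case
    unfolding w by simp
qed

definition hat :: "nat list \<Rightarrow> nat \<Rightarrow> nat" where
  "hat w = foldr (\<lambda>c f. cycle_of_list c \<circ> f) (ltr_blocks w) id"

lemma hat_example:
  "map (hat [2, 5, 3, 7, 1, 6, 4]) [1, 2, 3, 4, 5, 6, 7] = [6, 2, 5, 7, 3, 4, 1]"
  by (simp add: hat_def transpose_def)

text \<open>An arrow pattern is a word together with its arrows, the pair \<open>(b, c)\<close> being the arrow from
  \<open>b\<close> to \<open>c\<close>.\<close>

type_synonym arrow_pattern = "nat list \<times> (nat \<times> nat) set"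

definition pattern_letters :: "arrow_pattern \<Rightarrow> nat set" where
  "pattern_letters = (\<lambda>(\<nu>, H). set \<nu> \<union> fst ` H \<union> snd ` H)"

definition pattern_size :: "arrow_pattern \<Rightarrow> nat" where
  "pattern_size P = card (pattern_letters P)"

definition is_arrow_pattern :: "arrow_pattern \<Rightarrow> bool" where
  "is_arrow_pattern P \<longleftrightarrow> distinct (fst P) \<and> pattern_letters P = {1..pattern_size P}"

text \<open>The set \<open>X = {x\<^sub>1 < \<dots> < x\<^sub>k}\<close> is given by its increasing enumeration \<open>x\<close>.\<close>

definition contains :: "nat list \<Rightarrow> arrow_pattern \<Rightarrow> bool" where
  "contains w P \<longleftrightarrow> (case P of (\<nu>, H) \<Rightarrow>
     \<exists>(x :: nat \<Rightarrow> nat) (t :: nat \<Rightarrow> nat).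
       strict_mono_on {1..pattern_size P} x \<and>
       x ` {1..pattern_size P} \<subseteq> {1..length w} \<and>
       strict_mono_on {..<length \<nu>} t \<and>
       t ` {..<length \<nu>} \<subseteq> {..<length w} \<and>
       (\<forall>j<length \<nu>. w ! t j = x (\<nu> ! j)) \<and>
       (\<forall>(b, c)\<in>H. hat w (x b) = x c))"

definition avoiders :: "nat \<Rightarrow> arrow_pattern \<Rightarrow> nat list set" where
  "avoiders n P = {w \<in> permutations_of_set {1..n}. \<not> contains w P}"

lemma is_arrow_pattern_23_31: "is_arrow_pattern ([2, 3], {(3, 1)})"
proof -
  have "pattern_letters ([2, 3], {(3, 1)}) = {1..3}"
    by (auto simp: pattern_letters_def)
  then show ?thesis
    by (simp add: is_arrow_pattern_def pattern_size_def)
qed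

end

theory Submission
  imports Defs "HOL-Library.Sublist"
begin

text \<open>
  If \<open>hat w c < c\<close> then \<open>hat w c\<close> is the letter following \<open>c\<close> in the word, because the last letter of
  a block is sent to the head of the block, which is its maximum. Hence avoiding \<open>(23; 3 \<rightarrow> 1)\<close>
  means avoiding the vincular pattern \<open>2-31\<close>, which is the same as avoiding \<open>231\<close>: between the
  letters \<open>c\<close> and \<open>a\<close> of an occurrence \<open>b c a\<close> there are two adjacent letters at which the word
  drops from above \<open>b\<close> to below \<open>b\<close>. A word avoiding \<open>231\<close> splits at its maximum into two
  avoiding words, the first on the smaller letters, which gives the Catalan convolution.
\<close>

section \<open>The permutation \<open>hat w\<close> at its descents\<close>

lemma cycle_of_list_next:
  assumes "distinct (p @ c # a # q)"
  shows "cycle_of_list (p @ c # a # q) c = a"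
proof -
  let ?cs = "p @ c # a # q"
  have "map (cycle_of_list ?cs) ?cs = rotate1 ?cs"
    using cyclic_rotation[OF assms, of 1] by simp
  then have "map (cycle_of_list ?cs) ?cs ! length p = rotate1 ?cs ! length p"
    by simp
  then show ?thesis
    by (simp add: nth_rotate1 nth_append)
qed

lemma cycle_of_list_last:
  assumes "distinct (x # xs)"
  shows "cycle_of_list (x # xs) (last (x # xs)) = x"
proof -
  have "map (cycle_of_list (x # xs)) (x # xs) = xs @ [x]"
    using cyclic_rotation[OF assms, of 1] by simp
  then have "last (map (cycle_of_list (x # xs)) (x # xs)) = x"
    by simp
  then show ?thesis
    by (subst (asm) last_map) simp_all
qed

lemma hat_Nil [simp]: "hat [] = id"
  by (simp add: hat_def)

lemma hat_Cons:
  "hat (x # xs) = cycle_of_list (x # takeWhile (\<lambda>y. y \<le> x) xs) \<circ> hat (dropWhile (\<lambda>y. y \<le> x) xs)"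
  by (simp add: hat_def)

text \<open>Keeps the blocks apart: \<open>hat\<close> of the later blocks maps their letters among
  themselves and fixes the letters of the first block.\<close>

lemma hat_permutes: "hat w permutes set w"
proof (induction w rule: ltr_blocks.induct)
  case 1
  show ?case by (simp add: fun_eq_iff)
next
  case (2 x xs)
  let ?u = "x # takeWhile (\<lambda>y. y \<le> x) xs" and ?v = "dropWhile (\<lambda>y. y \<le> x) xs"
  have "set ?u \<subseteq> set (x # xs)" "set ?v \<subseteq> set (x # xs)"
    by (auto dest: set_takeWhileD set_dropWhileD)
  then show ?case
    unfolding hat_Cons
    by (intro permutes_compose permutes_subset[OF 2] permutes_subset[OF cycle_permutes])
qed

text \<open>Induction over the blocks. Inside a block the cycle follows the word, and its
  wrap-around leads to the maximum of the block, never below \<open>c\<close>. Conversely, no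
  descent straddles two blocks, since the head of the later one exceeds every letter before
  it.\<close>

lemma hat_less_iff_descent:
  assumes "distinct w" "c \<in> set w" "a < c"
  shows "hat w c = a \<longleftrightarrow> (\<exists>p q. w = p @ c # a # q)"
  using assms
proof (induction w rule: ltr_blocks.induct)
  case 1
  then show ?case by simp
next
  case (2 x xs)
  define u where "u = x # takeWhile (\<lambda>y. y \<le> x) xs"
  define v where "v = dropWhile (\<lambda>y. y \<le> x) xs"
  have w: "x # xs = u @ v"
    by (simp add: u_def v_def)
  have dist: "distinct u" "distinct v" "set u \<inter> set v = {}"
    using 2(2) unfolding w by auto
  have u_le: "y \<le> x" if "y \<in> set u" for y
    using that by (auto simp: u_def dest: set_takeWhileD)
  have hd_v: "x < hd v" if "v \<noteq> []"
    using that hd_dropWhile[of "\<lambda>y. y \<le> x" xs] by (simp add: v_def)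
  have hat: "hat (x # xs) c = cycle_of_list u (hat v c)"
    by (simp add: hat_Cons u_def v_def)
  show ?case
  proof (cases "c \<in> set v")
    case True
    have "hat v c \<in> set v"
      using True permutes_in_image[OF hat_permutes] by blast
    \<comment> \<open>The value stays among the letters of \<open>v\<close>, which the cycle on
      \<open>u\<close> fixes.\<close>
    then have "hat (x # xs) c = hat v c"
      using dist hat by (metis disjoint_iff id_outside_supp)
    moreover have "hat v c = a \<longleftrightarrow> (\<exists>p q. v = p @ c # a # q)"
      using 2(1) dist True 2(4) by (simp add: v_def)
    moreover have "(\<exists>p q. x # xs = p @ c # a # q) \<longleftrightarrow> (\<exists>p q. v = p @ c # a # q)"
    proof
      assume "\<exists>p q. x # xs = p @ c # a # q"
      then obtain p q where pq: "u @ v = p @ c # a # q" using w by auto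
      have "c \<notin> set u" using True dist by auto
      then obtain r where "p = u @ r" "v = r @ c # a # q"
        using pq by (auto simp: append_eq_append_conv2 append_eq_Cons_conv)
      then show "\<exists>p q. v = p @ c # a # q" by blast
    next
      assume "\<exists>p q. v = p @ c # a # q"
      then show "\<exists>p q. x # xs = p @ c # a # q"
        unfolding w by (metis append.assoc)
    qed
    ultimately show ?thesis by simp
  next
    case False
    then have c: "c \<in> set u" using 2(3) unfolding w by auto
    then obtain p r where u: "u = p @ c # r" by (meson split_list)
    have "hat v c = c"
      using False hat_permutes by (metis permutes_not_in)
    then have hat: "hat (x # xs) c = cycle_of_list u c"
      using hat by simp
    \<comment> \<open>Distinctness leaves a single occurrence of \<open>c\<close>, so any split of
      the word at \<open>c\<close> is the known one, continued past the block by
      \<open>v\<close>.\<close>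
    have uniq: "p' = p \<and> a # q' = r @ v" if "x # xs = p' @ c # a # q'" for p' q'
    proof -
      have eq: "p @ c # r @ v = p' @ c # a # q'" using that unfolding w u by simp
      have "distinct (p @ c # r @ v)" using 2(2) unfolding w u by simp
      then have "c \<notin> set p" "c \<notin> set (r @ v)" by auto
      then show ?thesis
        using eq append_Cons_eq_iff[of c p "r @ v" p' "a # q'"] by metis
    qed
    show ?thesis
    proof (cases r)
      \<comment> \<open>\<open>c\<close> ends its block and both sides are false: \<open>c\<close>
        is sent to \<open>x\<close>, which exceeds \<open>a\<close>, and the next letter, if any, is
        the head of \<open>v\<close>, larger than \<open>x\<close>.\<close>
      case Nil
      have "cycle_of_list u c = x"
        using cycle_of_list_last[of x "takeWhile (\<lambda>y. y \<le> x) xs"] dist(1) u Nil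
        unfolding u_def by (metis last_snoc)
      moreover have "a < x" using u_le[OF c] 2(4) by simp
      moreover have "\<not> (\<exists>p q. x # xs = p @ c # a # q)"
      proof
        assume "\<exists>p q. x # xs = p @ c # a # q"
        then obtain q' where "a # q' = v" using uniq Nil by fastforce
        then show False using hd_v \<open>a < x\<close> by (metis list.sel(1) list.discI not_less_iff_gr_or_eq)
      qed
      ultimately show ?thesis using hat by auto
    next
      case (Cons d r')
      have "cycle_of_list u c = d"
        using cycle_of_list_next dist(1) unfolding u Cons by metis
      moreover have "(\<exists>p q. x # xs = p @ c # a # q) \<longleftrightarrow> a = d"
      proof
        assume "\<exists>p q. x # xs = p @ c # a # q"
        then show "a = d" using uniq Cons by fastforce
      next
        assume "a = d"
        then have "x # xs = p @ c # a # r' @ v" unfolding w u Cons by simp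
        then show "\<exists>p q. x # xs = p @ c # a # q" by blast
      qed
      ultimately show ?thesis using hat by auto
    qed
  qed
qed

section \<open>Reduction to the classical pattern \<open>231\<close>\<close>

definition avoids_231 :: "'a::linorder list \<Rightarrow> bool" where
  "avoids_231 w \<longleftrightarrow> (\<forall>a b c. subseq [b, c, a] w \<longrightarrow> \<not> (a < b \<and> b < c))"

text \<open>Here \<open>a\<close>, \<open>b\<close>, \<open>c\<close> are the values
  \<open>x 1\<close>, \<open>x 2\<close>, \<open>x 3\<close>. As \<open>x 1 < x 3\<close>, the arrow
  is a descent of the word by \<open>hat_less_iff_descent\<close>, and the word 23 only asks that
  \<open>b\<close> stand before \<open>c\<close>.\<close>

lemma contains_23_31_iff:
  assumes "distinct w" "set w = {1..length w}"
  shows "contains w ([2, 3], {(3, 1)}) \<longleftrightarrow>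
    (\<exists>p q a b c. w = p @ c # a # q \<and> b \<in> set p \<and> a < b \<and> b < c)"
    (is "?L \<longleftrightarrow> ?R")
proof -
  have letters: "pattern_letters ([2, 3], {(3, 1)}) = {1..3}"
    by (auto simp: pattern_letters_def)
  then have size: "pattern_size ([2, 3], {(3, 1)}) = 3"
    by (simp add: pattern_size_def)
  have I: "{1..3::nat} = {1, 2, 3}" "{..<length [2, 3::nat]} = {0, 1}"
    by auto
  have contains_iff: "?L \<longleftrightarrow> (\<exists>(x :: nat \<Rightarrow> nat) (t :: nat \<Rightarrow> nat). strict_mono_on {1, 2, 3} x \<and>
      x ` {1, 2, 3} \<subseteq> {1..length w} \<and> strict_mono_on {0, 1} t \<and>
      t ` {0, 1} \<subseteq> {..<length w} \<and> (\<forall>j<2. w ! t j = x ([2, 3] ! j)) \<and>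
      hat w (x 3) = x 1)"
    unfolding contains_def prod.case size I by (simp add: numeral_2_eq_2)
  show ?thesis
  proof
    assume ?L
    then obtain x t :: "nat \<Rightarrow> nat" where
      x: "strict_mono_on {1, 2, 3} x" and
      t: "strict_mono_on {0, 1} t" "t ` {0, 1} \<subseteq> {..<length w}" and
      wt: "\<forall>j<2. w ! t j = x ([2, 3] ! j)" and
      hat: "hat w (x 3) = x 1"
      unfolding contains_iff by blast
    have x_less: "x 1 < x 2" "x 2 < x 3"
      using x by (auto simp: strict_mono_on_def)
    have t_less: "t 0 < t 1" "t 1 < length w"
      using t by (auto simp: strict_mono_on_def)
    have wt: "w ! t 0 = x 2" "w ! t 1 = x 3"
      using wt[rule_format, of 0] wt[rule_format, of 1] by simp_all
    have "x 3 \<in> set w"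
      using wt t_less by (metis nth_mem)
    then obtain p q where w: "w = p @ x 3 # x 1 # q"
      using hat_less_iff_descent[OF assms(1), of "x 3" "x 1"] x_less hat by auto
    \<comment> \<open>Distinct letters have unique positions, so \<open>t 1\<close> is the position
      just after \<open>p\<close>, and \<open>t 0 < t 1\<close> falls inside
      \<open>p\<close>.\<close>
    have "t 1 = length p"
      using assms(1) wt t_less w
      by (metis length_append add_less_cancel_left nth_append_length nth_eq_iff_index_eq
          length_Cons zero_less_Suc less_add_same_cancel1)
    then have "x 2 \<in> set p"
      using wt t_less w by (metis nth_append nth_mem)
    then show ?R
      using w x_less by blast
  next
    assume ?R
    then obtain p q a b c where w: "w = p @ c # a # q" and b: "b \<in> set p" and "a < b" "b < c"
      by blast
    obtain i where i: "i < length p" "p ! i = b"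
      using b by (auto simp: in_set_conv_nth)
    define x :: "nat \<Rightarrow> nat" where "x = (\<lambda>k. if k = 1 then a else if k = 2 then b else c)"
    define t :: "nat \<Rightarrow> nat" where "t = (\<lambda>k. if k = 0 then i else length p)"
    have "{a, b, c} \<subseteq> {1..length w}"
      unfolding assms(2)[symmetric] using b by (auto simp: w)
    moreover have "hat w c = a"
      using hat_less_iff_descent[OF assms(1), of c a] w \<open>a < b\<close> \<open>b < c\<close> by auto
    moreover have "w ! i = b" "w ! length p = c" "i < length w" "length p < length w"
      using i by (auto simp: w nth_append)
    ultimately have "strict_mono_on {1, 2, 3} x" "x ` {1, 2, 3} \<subseteq> {1..length w}"
      "strict_mono_on {0, 1} t" "t ` {0, 1} \<subseteq> {..<length w}"
      "\<forall>j<2. w ! t j = x ([2, 3] ! j)" "hat w (x 3) = x 1"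
      using \<open>a < b\<close> \<open>b < c\<close> i by (auto simp: x_def t_def strict_mono_on_def less_2_cases_iff)
    then show ?L
      unfolding contains_iff by blast
  qed
qed

text \<open>Reading from \<open>c\<close> towards \<open>a\<close>, the letters start above
  \<open>b\<close>, never equal \<open>b\<close> and eventually fall below it. The first letter
  below \<open>b\<close> and its predecessor are the required pair.\<close>

lemma descent_across:
  fixes b :: "'a::linorder"
  assumes "b < c" "a \<in> set r" "a < b" "b \<notin> set r"
  shows "\<exists>p q c' a'. c # r = p @ c' # a' # q \<and> a' < b \<and> b < c'"
  using assms
proof (induction r arbitrary: c)
  case Nil
  then show ?case by simp
next
  case (Cons y r)
  show ?case
  proof (cases "y < b")
    case True
    then show ?thesis using Cons.prems(1) by (metis append_Nil)
  next
    case False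
    then have "b < y" "a \<in> set r" using Cons.prems by auto
    then obtain p q c' a' where "y # r = p @ c' # a' # q" "a' < b" "b < c'"
      using Cons.IH[of y] Cons.prems by auto
    then show ?thesis by (metis append_Cons)
  qed
qed

lemma subseq_231E:
  assumes "subseq [b, c, a] w"
  obtains p r where "w = p @ c # r" "b \<in> set p" "a \<in> set r"
proof -
  have "subseq ([b] @ [c, a]) w" using assms by simp
  then obtain u v where w: "w = u @ v" and u: "subseq [b] u" and v: "subseq [c, a] v"
    by (blast dest: list_emb_appendD)
  obtain v1 r where "v = v1 @ c # r" "subseq [a] r"
    using v by (blast dest: list_emb_ConsD)
  then show thesis
    using that[of "u @ v1" r] w u by (simp add: subseq_singleton_left)
qed

lemma avoids_231_iff_vincular:
  assumes "distinct w"
  shows "avoids_231 w \<longleftrightarrow> \<not> (\<exists>p q a b c. w = p @ c # a # q \<and> b \<in> set p \<and> a < b \<and> b < c)"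
proof
  assume av: "avoids_231 w"
  show "\<not> (\<exists>p q a b c. w = p @ c # a # q \<and> b \<in> set p \<and> a < b \<and> b < c)"
  proof
    assume "\<exists>p q a b c. w = p @ c # a # q \<and> b \<in> set p \<and> a < b \<and> b < c"
    then obtain p q a b c where w: "w = p @ c # a # q" and "b \<in> set p" "a < b" "b < c"
      by blast
    then have "subseq ([b] @ [c, a]) (p @ c # a # q)"
      by (intro list_emb_append_mono) (auto simp: subseq_singleton_left)
    then show False
      using av \<open>a < b\<close> \<open>b < c\<close> unfolding avoids_231_def w by auto
  qed
next
  assume vinc: "\<not> (\<exists>p q a b c. w = p @ c # a # q \<and> b \<in> set p \<and> a < b \<and> b < c)"
  show "avoids_231 w"
    unfolding avoids_231_def
  proof (intro allI impI notI)
    fix a b c assume "subseq [b, c, a] w" and less: "a < b \<and> b < c"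
    from this(1) obtain p r where w: "w = p @ c # r" and p: "b \<in> set p" and "a \<in> set r"
      by (rule subseq_231E)
    moreover have "b \<notin> set r" using assms p w by auto
    ultimately obtain p' q c' a' where "c # r = p' @ c' # a' # q" "a' < b" "b < c'"
      using descent_across less by blast
    \<comment> \<open>The descent found lies after \<open>p\<close>, so the same \<open>b\<close>
      still precedes it.\<close>
    then have "w = (p @ p') @ c' # a' # q \<and> b \<in> set (p @ p') \<and> a' < b \<and> b < c'"
      using w p by simp
    then show False using vinc by blast
  qed
qed

lemma avoiders_23_31: "avoiders n ([2, 3], {(3, 1)}) = {w \<in> permutations_of_set {1..n}. avoids_231 w}"
proof -
  have "contains w ([2, 3], {(3, 1)}) \<longleftrightarrow> \<not> avoids_231 w" if "w \<in> permutations_of_set {1..n}" for w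
  proof -
    have "distinct w" "set w = {1..length w}"
      using that length_finite_permutations_of_set[OF that] by (auto simp: permutations_of_set_def)
    then show ?thesis
      using contains_23_31_iff avoids_231_iff_vincular by metis
  qed
  then show ?thesis
    by (auto simp: avoiders_def)
qed

section \<open>Counting\<close>

lemma subseq_set_subset: "subseq xs ys \<Longrightarrow> set xs \<subseteq> set ys"
  by (auto elim: list_emb_set)

text \<open>The greatest letter can only play the role of the 3. Any occurrence not contained in
  \<open>u\<close> or in \<open>v\<close> takes its 2 from \<open>u\<close> and its 1 from
  \<open>v\<close>, which the comparison of \<open>u\<close> with \<open>v\<close> excludes;
  conversely, a larger letter in \<open>u\<close> than in \<open>v\<close> forms an occurrence with
  \<open>m\<close> between them.\<close>

lemma avoids_231_append_max:
  assumes "\<And>x. x \<in> set u \<Longrightarrow> x < m" "\<And>x. x \<in> set v \<Longrightarrow> x < m"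
  shows "avoids_231 (u @ m # v) \<longleftrightarrow>
    avoids_231 u \<and> avoids_231 v \<and> (\<forall>x\<in>set u. \<forall>y\<in>set v. x \<le> y)"
proof (intro iffI conjI ballI)
  assume av: "avoids_231 (u @ m # v)"
  have "subseq u (u @ m # v)" "subseq v (u @ m # v)"
    by auto
  then show "avoids_231 u" "avoids_231 v"
    using av unfolding avoids_231_def by (meson subseq_order.order_trans)+
  fix x y assume x: "x \<in> set u" and y: "y \<in> set v"
  have "subseq ([x] @ [m, y]) (u @ m # v)"
    using x y by (intro list_emb_append_mono) (simp_all add: subseq_singleton_left)
  then show "x \<le> y"
    using av assms(1)[OF x] unfolding avoids_231_def by (metis append_Cons append_Nil not_le)
next
  assume R: "avoids_231 u \<and> avoids_231 v \<and> (\<forall>x\<in>set u. \<forall>y\<in>set v. x \<le> y)"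
  show "avoids_231 (u @ m # v)"
    unfolding avoids_231_def
  proof (intro allI impI notI)
    fix a b c assume s: "subseq [b, c, a] (u @ m # v)" and less: "a < b \<and> b < c"
    have bound: "x \<le> m" if "x \<in> set (u @ m # v)" for x
      using that assms by (auto intro: less_imp_le)
    have "{b, c, a} \<subseteq> set (u @ m # v)"
      using s by (auto dest: subseq_set_subset)
    then have "c \<le> m" using bound by auto
    then have m: "a \<noteq> m" "b \<noteq> m" using less by auto
    from s obtain s1 s2 where "[b, c, a] = s1 @ s2" and s: "subseq s1 u" "subseq s2 (m # v)"
      by (rule subseq_appendE)
    \<comment> \<open>The cases follow the cut of the occurrence: nothing in \<open>u\<close>,
      everything in \<open>u\<close>, or at least its first letter in \<open>u\<close> and its last
      one outside.\<close>
    then consider "s2 = [b, c, a]" | "s1 = [b, c, a]" | "b \<in> set u" "a \<in> set (m # v)"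
      by (auto simp: Cons_eq_append_conv dest!: subseq_set_subset)
    then show False
    proof cases
      case 1
      then have "subseq [b, c, a] v" using s m by (metis subseq_Cons2_neq)
      then show ?thesis using R less unfolding avoids_231_def by blast
    next
      case 2
      then show ?thesis using R s less unfolding avoids_231_def by blast
    next
      case 3
      then show ?thesis using R m less by force
    qed
  qed
qed

definition avoiders_231 :: "'a::linorder set \<Rightarrow> 'a list set" where
  "avoiders_231 A = {w \<in> permutations_of_set A. avoids_231 w}"

lemma finite_avoiders_231: "finite (avoiders_231 A)"
  by (simp add: avoiders_231_def)

text \<open>Supplies the split size \<open>k\<close> of the Catalan recursion. The cut is at the
  least element of \<open>B\<close>, or at the right end if \<open>B\<close> is empty.\<close>

lemma initial_segment_of_interval:
  fixes A B :: "nat set"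
  assumes "A \<union> B = {a..<b}" "\<And>x y. x \<in> A \<Longrightarrow> y \<in> B \<Longrightarrow> x < y"
  obtains k where "k \<le> b - a" "A = {a..<a + k}" "B = {a + k..<b}"
proof (cases "B = {}")
  case True
  show thesis
  proof (rule that)
    show "b - a \<le> b - a" ..
    show "A = {a..<a + (b - a)}" "B = {a + (b - a)..<b}" using True assms(1) by auto
  qed
next
  case False
  define s where "s = Inf B"
  have s: "s \<in> B" "\<And>y. y \<in> B \<Longrightarrow> s \<le> y"
    using False by (auto simp: s_def Inf_nat_def1 cInf_lower)
  have "s \<in> {a..<b}" using s assms(1) by blast
  then have k: "s - a \<le> b - a" "a + (s - a) = s" by auto
  have in_A: "x \<in> A \<longleftrightarrow> x \<in> {a..<b} \<and> x < s" and in_B: "x \<in> B \<longleftrightarrow> x \<in> {a..<b} \<and> s \<le> x" for x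
    using assms(1)[symmetric] assms(2)[of x s] s(1) s(2)[of x] by (auto simp: not_less)
  then have "A = {a..<s}" "B = {s..<b}"
    using \<open>s \<in> {a..<b}\<close> by (auto simp only: set_eq_iff in_A in_B atLeastLessThan_iff intro: le_trans less_trans)
  then show thesis using that[of "s - a"] k by simp
qed

text \<open>Cut at the greatest letter \<open>a + n\<close>; \<open>k\<close> counts the letters
  before it. Intervals with an arbitrary left end are used so that the right factor, whose letters
  start at \<open>a + k\<close>, is of the same kind.\<close>

lemma avoiders_231_interval_Suc:
  "avoiders_231 {a..<a + Suc n} =
    (\<Union>k\<le>n. (\<lambda>(u, v). u @ (a + n) # v) ` (avoiders_231 {a..<a + k} \<times> avoiders_231 {a + k..<a + n}))"
    (is "?L = (\<Union>k\<le>n. ?f ` ?P k)")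
proof (intro equalityI subsetI)
  fix w assume "w \<in> ?L"
  then have w: "set w = {a..<a + Suc n}" "distinct w" "avoids_231 w"
    by (auto simp: avoiders_231_def permutations_of_set_def)
  then have "a + n \<in> set w" by simp
  then obtain u v where uv: "w = u @ (a + n) # v" by (meson split_list)
  have sets: "set u \<union> set v = {a..<a + n}"
  proof -
    have "set u \<union> set v = set w - {a + n}" using w(2) by (auto simp: uv)
    also have "\<dots> = {a..<a + n}" unfolding w(1) by auto
    finally show ?thesis .
  qed
  have "\<And>x. x \<in> set u \<Longrightarrow> x < a + n" "\<And>x. x \<in> set v \<Longrightarrow> x < a + n"
    using sets by auto
  from avoids_231_append_max[OF this]
  have av: "avoids_231 u" "avoids_231 v" "\<forall>x\<in>set u. \<forall>y\<in>set v. x \<le> y"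
    using w(3) uv by auto
  \<comment> \<open>Distinctness sharpens the weak inequality from
    \<open>avoids_231_append_max\<close>.\<close>
  have "x < y" if "x \<in> set u" "y \<in> set v" for x y
    using that av(3) w(2) unfolding uv by (metis IntI distinct_append empty_iff le_neq_implies_less list.set_intros(2))
  then obtain k where "k \<le> n" "set u = {a..<a + k}" "set v = {a + k..<a + n}"
    using initial_segment_of_interval[OF sets] by auto
  moreover have "distinct u" "distinct v"
    using w(2) by (auto simp: uv)
  ultimately have "k \<in> {..n}" "(u, v) \<in> ?P k" "w = ?f (u, v)"
    using av(1,2) by (simp_all add: uv avoiders_231_def permutations_of_set_def)
  then show "w \<in> (\<Union>k\<le>n. ?f ` ?P k)"
    by blast
next
  fix w assume "w \<in> (\<Union>k\<le>n. ?f ` ?P k)"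
  then obtain k u v where k: "k \<le> n" and w: "w = u @ (a + n) # v"
    and uv: "u \<in> avoiders_231 {a..<a + k}" "v \<in> avoiders_231 {a + k..<a + n}"
    by auto
  then have u: "set u = {a..<a + k}" "distinct u" "avoids_231 u"
    and v: "set v = {a + k..<a + n}" "distinct v" "avoids_231 v"
    by (auto simp: avoiders_231_def permutations_of_set_def)
  have "avoids_231 w"
    unfolding w by (subst avoids_231_append_max) (use u v k in auto)
  moreover have "set w = {a..<a + Suc n}" "distinct w"
    using u v k by (auto simp: w)
  ultimately show "w \<in> ?L"
    by (simp add: avoiders_231_def permutations_of_set_def)
qed

text \<open>The decomposition is unique: the only occurrence of \<open>a + n\<close> determines
  \<open>u\<close> and \<open>v\<close>, and the number of letters of \<open>u\<close> determines
  \<open>k\<close>.\<close>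

lemma card_avoiders_231_interval_Suc:
  "card (avoiders_231 {a..<a + Suc n}) =
    (\<Sum>k\<le>n. card (avoiders_231 {a..<a + k}) * card (avoiders_231 {a + k..<a + n}))"
proof -
  let ?f = "\<lambda>(u, v). u @ (a + n) # v"
  let ?P = "\<lambda>k. avoiders_231 {a..<a + k} \<times> avoiders_231 {a + k..<a + n}"
  have uniq: "u = u' \<and> v = v'"
    if "(u, v) \<in> ?P k" "(u', v') \<in> ?P k'" "k \<le> n" "k' \<le> n" "?f (u, v) = ?f (u', v')"
    for u v u' v' k k'
  proof -
    have "a + n \<notin> set u" "a + n \<notin> set v" "a + n \<notin> set u'"
      using that by (auto simp: avoiders_231_def permutations_of_set_def)
    then show ?thesis
      using that(5) append_Cons_eq_iff[of "a + n" u v u' v'] by simp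
  qed
  have inj: "inj_on ?f (?P k)" if "k \<le> n" for k
    using uniq[OF _ _ that that] by (force simp: inj_on_def)
  have disj: "?f ` ?P k \<inter> ?f ` ?P k' = {}" if "k \<le> n" "k' \<le> n" "k \<noteq> k'" for k k'
  proof (rule ccontr)
    assume "?f ` ?P k \<inter> ?f ` ?P k' \<noteq> {}"
    then obtain u v u' v' where P: "(u, v) \<in> ?P k" "(u', v') \<in> ?P k'" "?f (u, v) = ?f (u', v')"
      by fastforce
    then have "u = u'" using uniq[OF P(1,2) that(1,2) P(3)] by simp
    then have "{a..<a + k} = {a..<a + k'}"
      using P by (auto simp: avoiders_231_def permutations_of_set_def)
    then have "card {a..<a + k} = card {a..<a + k'}" by simp
    then show False using that(3) by simp
  qed
  have "card (avoiders_231 {a..<a + Suc n}) = (\<Sum>k\<le>n. card (?f ` ?P k))"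
    unfolding avoiders_231_interval_Suc
    by (rule card_UN_disjoint) (use disj in \<open>auto simp: finite_avoiders_231\<close>)
  also have "\<dots> = (\<Sum>k\<le>n. card (?P k))"
    by (intro sum.cong refl card_image inj) simp
  finally show ?thesis
    by (simp add: card_cartesian_product)
qed

section \<open>The Catalan convolution\<close>

text \<open>Real-valued, so that the division is exact and the recurrences can be handled in a
  field.\<close>

definition catalan :: "nat \<Rightarrow> real" where
  "catalan n = real ((2 * n) choose n) / (real n + 1)"

lemma catalan_0 [simp]: "catalan 0 = 1"
  by (simp add: catalan_def)

text \<open>The absorption identity is applied twice, passing through row \<open>2 * n + 1\<close>,
  whose two middle binomial coefficients agree by symmetry.\<close>

lemma catalan_Suc: "(real n + 2) * catalan (Suc n) = (4 * real n + 2) * catalan n"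
proof -
  have 1: "Suc n * (Suc (Suc (2 * n)) choose Suc n) = Suc (Suc (2 * n)) * (Suc (2 * n) choose n)"
    by (rule Suc_times_binomial)
  have 2: "Suc n * (Suc (2 * n) choose Suc n) = Suc (2 * n) * (2 * n choose n)"
    by (rule Suc_times_binomial)
  have 3: "(Suc (2 * n) choose Suc n) = (Suc (2 * n) choose n)"
    using binomial_symmetric[of n "Suc (2 * n)"] by simp
  have 4: "Suc (Suc (2 * n)) = 2 * Suc n"
    by simp
  have "Suc n * (2 * Suc n choose Suc n) = 2 * (Suc n * (Suc (2 * n) choose n))"
    using 1 unfolding 4 by (simp only: mult.assoc)
  also have "\<dots> = 2 * (Suc (2 * n) * (2 * n choose n))"
    using 2 unfolding 3 by (simp only:)
  finally have "real (Suc n * (2 * Suc n choose Suc n)) = real (2 * (Suc (2 * n) * (2 * n choose n)))"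
    by (rule arg_cong)
  then have "(real n + 1) * real (2 * Suc n choose Suc n) = (4 * real n + 2) * real (2 * n choose n)"
    by (simp add: algebra_simps del: binomial_Suc_Suc)
  then show ?thesis
    unfolding catalan_def by (simp add: field_simps del: binomial_Suc_Suc)
qed

text \<open>A weighted form of the sum can be evaluated with the first-order recurrence
  \<open>catalan_Suc\<close> and the induction hypothesis. Symmetry then removes the weight and
  shows that \<open>T\<close> satisfies the same recurrence as \<open>catalan\<close>.\<close>

lemma catalan_convolution: "(\<Sum>k\<le>n. catalan k * catalan (n - k)) = catalan (Suc n)"
proof (induction n)
  case 0
  show ?case by (simp add: catalan_def)
next
  case (Suc n)
  define T where "T = (\<Sum>k\<le>Suc n. catalan k * catalan (Suc n - k))"
  define W where "W = (\<lambda>m. \<Sum>k\<le>m. real k * (catalan k * catalan (m - k)))"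
  \<comment> \<open>By the symmetry \<open>k \<leftrightarrow> m - k\<close> the weight \<open>k\<close> may be replaced by its average \<open>m / 2\<close>.\<close>
  have sym: "2 * W m = real m * (\<Sum>k\<le>m. catalan k * catalan (m - k))" for m
  proof -
    have "W m = (\<Sum>k\<le>m. real (m - k) * (catalan k * catalan (m - k)))"
      unfolding W_def
      by (rule sum.reindex_bij_witness[of _ "\<lambda>k. m - k" "\<lambda>k. m - k"]) (auto simp: mult_ac)
    then have "2 * W m = (\<Sum>k\<le>m. real k * (catalan k * catalan (m - k)) + real (m - k) * (catalan k * catalan (m - k)))"
      by (simp add: W_def sum.distrib)
    also have "\<dots> = (\<Sum>k\<le>m. real m * (catalan k * catalan (m - k)))"
      by (intro sum.cong refl) (simp add: of_nat_diff algebra_simps)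
    finally show ?thesis by (simp add: sum_distrib_left)
  qed
  \<comment> \<open>The weight \<open>k + 1\<close> becomes \<open>k + 2\<close> after the index
    shift, just the factor on the left of \<open>catalan_Suc\<close>; the term at 0 splits off as
    \<open>catalan (Suc n)\<close>.\<close>
  have "W (Suc n) + T = (\<Sum>k\<le>Suc n. (real k + 1) * (catalan k * catalan (Suc n - k)))"
    by (simp only: W_def T_def sum.distrib[symmetric]) (simp only: distrib_right mult_1_left)
  also have "\<dots> = catalan (Suc n) + (\<Sum>k\<le>n. (real k + 2) * catalan (Suc k) * catalan (n - k))"
    by (subst sum.atMost_Suc_shift) (simp add: algebra_simps)
  also have "\<dots> = catalan (Suc n) + (\<Sum>k\<le>n. (4 * real k + 2) * catalan k * catalan (n - k))"
    by (simp only: catalan_Suc)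
  also have "(\<Sum>k\<le>n. (4 * real k + 2) * catalan k * catalan (n - k)) =
      4 * W n + 2 * (\<Sum>k\<le>n. catalan k * catalan (n - k))"
    by (simp add: W_def sum_distrib_left sum.distrib[symmetric] algebra_simps)
  \<comment> \<open>By symmetry \<open>4 * W n\<close> is \<open>2 * n\<close> times the
    convolution, which is \<open>catalan (Suc n)\<close> by induction.\<close>
  also have "\<dots> = (2 * real n + 2) * catalan (Suc n)"
    using sym[of n] Suc by (simp add: algebra_simps)
  finally have "2 * W (Suc n) + 2 * T = (4 * real (Suc n) + 2) * catalan (Suc n)"
    by (simp add: algebra_simps)
  moreover have "2 * W (Suc n) = real (Suc n) * T"
    using sym[of "Suc n"] by (simp only: T_def)
  ultimately have "(real (Suc n) + 2) * T = (real (Suc n) + 2) * catalan (Suc (Suc n))"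
    unfolding catalan_Suc by (simp add: algebra_simps)
  then have "T = catalan (Suc (Suc n))"
    by simp
  then show ?case by (simp only: T_def)
qed

text \<open>Strong induction with \<open>a\<close> arbitrary, because the right factor is an
  interval of length \<open>m - k\<close> starting at \<open>a + k\<close>.\<close>

lemma card_avoiders_231_interval: "real (card (avoiders_231 {a..<a + n})) = catalan n"
proof (induction n arbitrary: a rule: less_induct)
  case (less n)
  show ?case
  proof (cases n)
    case 0
    have "avoiders_231 {a..<a + 0} = {[]}"
      by (auto simp: avoiders_231_def avoids_231_def)
    then show ?thesis using 0 by simp
  next
    case (Suc m)
    have "real (card (avoiders_231 {a..<a + Suc m})) =
      (\<Sum>k\<le>m. real (card (avoiders_231 {a..<a + k})) * real (card (avoiders_231 {a + k..<a + m})))"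
      unfolding card_avoiders_231_interval_Suc by simp
    also have "\<dots> = (\<Sum>k\<le>m. catalan k * catalan (m - k))"
    proof (intro sum.cong refl)
      fix k assume "k \<in> {..m}"
      then have "real (card (avoiders_231 {a..<a + k})) = catalan k"
        "real (card (avoiders_231 {a + k..<a + m})) = catalan (m - k)"
        using less[of k a] less[of "m - k" "a + k"] Suc by simp_all
      then show "real (card (avoiders_231 {a..<a + k})) * real (card (avoiders_231 {a + k..<a + m})) =
          catalan k * catalan (m - k)"
        by simp
    qed
    finally show ?thesis using Suc catalan_convolution by simp
  qed
qed

theorem theorem5p3:
  fixes n :: nat
  assumes "n \<ge> 1"
  shows "real (card (avoiders n ([2, 3], {(3, 1)}))) =
           1 / (real n + 1) * real ((2 * n) choose n)"
proof -
  have "avoiders n ([2, 3], {(3, 1)}) = avoiders_231 {1..<1 + n}"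
    unfolding avoiders_23_31 avoiders_231_def by (simp add: atLeastLessThanSuc_atLeastAtMost)
  then show ?thesis
    using card_avoiders_231_interval[of 1 n] by (simp add: catalan_def)
qed

end
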